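(* Let $G=(V,E)$ be a finite graph (multiple edges and loops allowed) with $V=\{v_1,\dots,v_n\}$, let $q\in\mathbb{N}$, and consider the $q$-state Potts model on $G$ with edge interaction energies $J_e<0$ for all $e\in E$ (antiferromagnetic) and external field contributions $\boldsymbol{M}_i=(M_{i,1},\dots,M_{i,q})$ at each vertex $v_i$ with all entries real and non-positive, $M_{i,\alpha}\le 0$. For each $i$ let $l_i=\{r\in\{1,\dots,q\}: M_{i,r}=0\}$ and $L=\{l_i\}_{i\in V}$. Then $$\lim_{T\to 0} Z(G,\boldsymbol{J},\boldsymbol{M};q,T)=P(G,L)\big|_{\{x_l=|l|\}},$$ i.e. the zero-temperature limit of the partition function equals the list-chromatic polynomial of $(G,L)$ evaluated at $x_l=|l|$ for every indeterminate $x_l$, which is the number of proper colorings of $G$ assigning to each $v_i$ a color from $l_i$.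
   Context: A state of $G$ is a map $\sigma:V\to\{1,\dots,q\}$, writing $\sigma_i=\sigma(v_i)$. The Hamiltonian is $$h(\sigma)=-\sum_{\{i,j\}\in E}J_{i,j}\,\delta(\sigma_i,\sigma_j)-\sum_{v_i\in V}\sum_{\alpha=1}^q M_{i,\alpha}\,\delta(\alpha,\sigma_i),$$ where $\delta$ is the Kronecker delta and the first sum runs over all edges (with multiplicity, loops included). The partition function is $Z(G,\boldsymbol{J},\boldsymbol{M};q,T)=\sum_{\sigma}\mathrm{e}^{-\beta h(\sigma)}$ over all states, with $\beta=1/(\kappa T)$, $T>0$ the temperature and $\kappa>0$ Boltzmann's constant. List-chromatic polynomial: for each subset $l\subseteq\{1,\dots,q\}$ introduce an indeterminate $x_l$; then $P(G,L)=\sum_{A\subseteq E}(-1)^{|A|}x_{c_1}\cdots x_{c_{k(A)}}$, where $k(A)$ is the number of connected components of the spanning subgraph $(V,A)$ and $c_j$ is the intersection of the lists $l_i$ of the vertices in the $j$-th component. *)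

theory Defs
  imports Complex_Main "HOL-Library.FuncSet" "HOL-Library.Uprod" "HOL-Library.Poly_Mapping"
begin

(* Edges have identities of their own, so multiplicities are allowed; an unordered pair
   "Upair v v" is a loop. *)
record ('v, 'e) multigraph =
  verts :: "'v set"
  edges :: "'e set"
  ends :: "'e \<Rightarrow> 'v uprod"

locale finite_multigraph =
  fixes G :: "('v, 'e) multigraph"
  assumes finite_verts: "finite (verts G)"
    and finite_edges: "finite (edges G)"
    and ends_in_verts: "e \<in> edges G \<Longrightarrow> set_uprod (ends G e) \<subseteq> verts G"

definition kdelta :: "nat \<Rightarrow> nat \<Rightarrow> real" where
  "kdelta a b = (if a = b then 1 else 0)"

lift_definition kdelta_uprod :: "nat uprod \<Rightarrow> real" is "\<lambda>(a, b). kdelta a b"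
  by (auto simp: kdelta_def)

lemma kdelta_uprod_Upair [simp]: "kdelta_uprod (Upair a b) = kdelta a b"
  by transfer simp

definition states :: "('v, 'e) multigraph \<Rightarrow> nat \<Rightarrow> ('v \<Rightarrow> nat) set" where
  "states G q = verts G \<rightarrow>\<^sub>E {1..q}"

definition hamiltonian ::
  "('v, 'e) multigraph \<Rightarrow> ('e \<Rightarrow> real) \<Rightarrow> ('v \<Rightarrow> nat \<Rightarrow> real) \<Rightarrow> nat \<Rightarrow> ('v \<Rightarrow> nat) \<Rightarrow> real" where
  "hamiltonian G J M q \<sigma> =
     - (\<Sum>e\<in>edges G. J e * kdelta_uprod (map_uprod \<sigma> (ends G e)))
     - (\<Sum>v\<in>verts G. \<Sum>\<alpha>=1..q. M v \<alpha> * kdelta \<alpha> (\<sigma> v))"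

definition partition_function ::
  "real \<Rightarrow> ('v, 'e) multigraph \<Rightarrow> ('e \<Rightarrow> real) \<Rightarrow> ('v \<Rightarrow> nat \<Rightarrow> real) \<Rightarrow> nat \<Rightarrow> real \<Rightarrow> real" where
  "partition_function \<kappa> G J M q T =
     (let \<beta> = 1 / (\<kappa> * T) in \<Sum>\<sigma>\<in>states G q. exp (- \<beta> * hamiltonian G J M q \<sigma>))"

definition adjacency :: "('v, 'e) multigraph \<Rightarrow> 'e set \<Rightarrow> ('v \<times> 'v) set" where
  "adjacency G A = {(u, v). \<exists>e\<in>A. ends G e = Upair u v}"

definition components :: "('v, 'e) multigraph \<Rightarrow> 'e set \<Rightarrow> 'v set set" where
  "components G A = verts G // {(u, v) \<in> verts G \<times> verts G. (u, v) \<in> (adjacency G A)\<^sup>*}"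

(* Integer polynomials in indeterminates indexed by 'i: finitely supported maps from
   monomials (finitely supported exponent maps) to coefficients. *)
type_synonym 'i int_mpoly = "('i \<Rightarrow>\<^sub>0 nat) \<Rightarrow>\<^sub>0 int"

definition indet :: "'i \<Rightarrow> 'i int_mpoly" where
  "indet i = Poly_Mapping.single (Poly_Mapping.single i 1) 1"

definition eval_mpoly :: "('i \<Rightarrow> 'a::comm_ring_1) \<Rightarrow> 'i int_mpoly \<Rightarrow> 'a" where
  "eval_mpoly x p =
     (\<Sum>m\<in>Poly_Mapping.keys p.
        of_int (Poly_Mapping.lookup p m) *
        (\<Prod>i\<in>Poly_Mapping.keys m. x i ^ Poly_Mapping.lookup m i))"

definition list_chromatic_poly ::
  "('v, 'e) multigraph \<Rightarrow> ('v \<Rightarrow> nat set) \<Rightarrow> nat set int_mpoly" where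
  "list_chromatic_poly G L =
     (\<Sum>A\<in>Pow (edges G). (- 1) ^ card A * (\<Prod>C\<in>components G A. indet (\<Inter>v\<in>C. L v)))"

definition zero_field_list :: "('v \<Rightarrow> nat \<Rightarrow> real) \<Rightarrow> nat \<Rightarrow> 'v \<Rightarrow> nat set" where
  "zero_field_list M q v = {r \<in> {1..q}. M v r = 0}"

definition proper_list_colorings ::
  "('v, 'e) multigraph \<Rightarrow> ('v \<Rightarrow> nat set) \<Rightarrow> ('v \<Rightarrow> nat) set" where
  "proper_list_colorings G L =
     {c \<in> Pi\<^sub>E (verts G) L. \<forall>e\<in>edges G. \<forall>u v. ends G e = Upair u v \<longrightarrow> c u \<noteq> c v}"

end

theory Submission
  imports Defs
begin

text \<open>
  A colouring that is constant along the edges of \<open>A\<close> amounts to one colour for each component of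
  \<open>(V, A)\<close>, so at \<open>x\<^sub>l = |l|\<close> the summand of \<open>A\<close> counts the list colourings for which every edge of
  \<open>A\<close> is monochromatic; inclusion-exclusion over \<open>A\<close> leaves the proper ones. On the other side
  every energy is non-negative, and it vanishes exactly on the proper colourings from the
  zero-field lists, so as the temperature tends to 0 each Boltzmann weight tends to the indicator
  of being such a colouring.
\<close>

section \<open>Evaluation of polynomials\<close>

text \<open>The monomial factor of \<open>eval_mpoly\<close> gets its own name because
  multiplicativity is proved first for monomials, where multiplying means adding exponents.\<close>

definition eval_monom :: "('i \<Rightarrow> 'a::comm_ring_1) \<Rightarrow> ('i \<Rightarrow>\<^sub>0 nat) \<Rightarrow> 'a" where
  "eval_monom x m = (\<Prod>i\<in>Poly_Mapping.keys m. x i ^ Poly_Mapping.lookup m i)"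

lemma eval_mpoly_altdef:
  "eval_mpoly x p = (\<Sum>m\<in>Poly_Mapping.keys p. of_int (Poly_Mapping.lookup p m) * eval_monom x m)"
  by (simp add: eval_mpoly_def eval_monom_def)

text \<open>Indices outside the keys have exponent 0 and contribute the factor 1. This lets
  monomials with different supports be compared over one index set.\<close>

lemma eval_monom_superset:
  assumes "finite S" "Poly_Mapping.keys m \<subseteq> S"
  shows "eval_monom x m = (\<Prod>i\<in>S. x i ^ Poly_Mapping.lookup m i)"
  unfolding eval_monom_def
  by (rule prod.mono_neutral_left) (use assms in \<open>auto simp: in_keys_iff\<close>)

lemma eval_monom_add: "eval_monom x (m + n) = eval_monom x m * eval_monom x n"
proof -
  let ?S = "Poly_Mapping.keys m \<union> Poly_Mapping.keys n"
  have "eval_monom x (m + n) = (\<Prod>i\<in>?S. x i ^ Poly_Mapping.lookup (m + n) i)"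
    by (rule eval_monom_superset) (simp_all add: keys_add)
  also have "\<dots> = eval_monom x m * eval_monom x n"
    by (simp add: eval_monom_superset[of ?S] lookup_add power_add prod.distrib)
  finally show ?thesis .
qed

lemma eval_mpoly_0 [simp]: "eval_mpoly x 0 = 0"
  by (simp add: eval_mpoly_def)

lemma eval_mpoly_single [simp]:
  "eval_mpoly x (Poly_Mapping.single m c) = of_int c * eval_monom x m"
  by (simp add: eval_mpoly_altdef)

lemma eval_mpoly_add [simp]: "eval_mpoly x (p + q) = eval_mpoly x p + eval_mpoly x q"
  unfolding eval_mpoly_altdef
  by (rule setsum_keys_plus_distrib) (simp_all add: distrib_right)

text \<open>Turns the step of \<open>update_induct\<close>, which inserts a fresh key, into a sum,
  so that additivity of evaluation applies.\<close>

lemma update_conv_single_add: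
  assumes "a \<notin> Poly_Mapping.keys f"
  shows "Poly_Mapping.update a b f = Poly_Mapping.single a b + f"
  by (rule poly_mapping_eqI)
    (use assms in \<open>auto simp: lookup_update lookup_add lookup_single in_keys_iff when_def\<close>)

text \<open>Multiplicativity extends bilinearly from monomials: here the left factor is a single
  term, and a second induction then frees it.\<close>

lemma eval_mpoly_single_mult:
  "eval_mpoly x (Poly_Mapping.single m c * q) = of_int c * eval_monom x m * eval_mpoly x q"
proof (induction q rule: update_induct)
  case const
  then show ?case by simp
next
  case (update f a b)
  then show ?case
    by (simp add: update_conv_single_add distrib_left mult_single eval_monom_add)
qed

lemma eval_mpoly_mult [simp]: "eval_mpoly x (p * q) = eval_mpoly x p * eval_mpoly x q"
proof (induction p rule: update_induct)
  case const
  then show ?case by simp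
next
  case (update f a b)
  then show ?case
    by (simp add: update_conv_single_add distrib_right eval_mpoly_single_mult)
qed

lemma eval_mpoly_1 [simp]: "eval_mpoly x 1 = 1"
  by (simp add: eval_mpoly_def)

lemma eval_mpoly_uminus [simp]: "eval_mpoly x (- p) = - eval_mpoly x p"
  using eval_mpoly_add[of x p "- p"] by (simp add: minus_unique)

lemma eval_mpoly_power [simp]: "eval_mpoly x (p ^ n) = eval_mpoly x p ^ n"
  by (induction n) simp_all

lemma eval_mpoly_sum [simp]: "eval_mpoly x (\<Sum>i\<in>I. f i) = (\<Sum>i\<in>I. eval_mpoly x (f i))"
  by (induction I rule: infinite_finite_induct) simp_all

lemma eval_mpoly_prod [simp]: "eval_mpoly x (\<Prod>i\<in>I. f i) = (\<Prod>i\<in>I. eval_mpoly x (f i))"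
  by (induction I rule: infinite_finite_induct) simp_all

lemma eval_mpoly_indet [simp]: "eval_mpoly x (indet i) = x i"
  by (simp add: indet_def eval_monom_def)

lemma eval_list_chromatic_poly:
  "eval_mpoly x (list_chromatic_poly G L) =
     (\<Sum>A\<in>Pow (edges G). (- 1) ^ card A * (\<Prod>C\<in>components G A. x (\<Inter>v\<in>C. L v)))"
  by (simp add: list_chromatic_poly_def)

section \<open>Counting list colourings\<close>

text \<open>A function constant on the classes is a free choice of one value per class, and that
  value must lie in the list of every member, hence in the intersection.\<close>

lemma card_PiE_constant_on_classes:
  assumes "finite V" and r: "equiv V r"
  shows "card {f \<in> Pi\<^sub>E V L. \<forall>(u, v)\<in>r. f u = f v} = (\<Prod>C\<in>V // r. card (\<Inter>v\<in>C. L v))"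
proof -
  \<comment> \<open>\<open>\<Phi>\<close> spreads the value of a class over its members;
    \<open>\<Psi>\<close> reads it off at an arbitrary representative. Both are
    \<open>undefined\<close> outside their domains, so they are mutually inverse as extensional
    functions.\<close>
  define \<Phi> where "\<Phi> g = (\<lambda>v\<in>V. g (r `` {v}))" for g :: "'a set \<Rightarrow> 'b"
  define \<Psi> where "\<Psi> f = (\<lambda>C\<in>V // r. f (SOME v. v \<in> C))" for f :: "'a \<Rightarrow> 'b"
  have some_in: "(SOME v. v \<in> C) \<in> C" if "C \<in> V // r" for C
    using in_quotient_imp_non_empty[OF r that] by (simp add: some_in_eq)
  have class_subset: "C \<subseteq> V" if "C \<in> V // r" for C
    using in_quotient_imp_subset[OF r that] .
  have class_eq: "r `` {v} = C" if "C \<in> V // r" "v \<in> C" for C v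
    using that r by (metis Image_singleton_iff equiv_class_eq_iff quotientE)
  have class_rel: "(u, v) \<in> r" if "C \<in> V // r" "u \<in> C" "v \<in> C" for C u v
    using in_quotient_imp_in_rel[OF r that(1), of u v] that by simp
  have "bij_betw \<Phi> (\<Pi>\<^sub>E C\<in>V // r. \<Inter>v\<in>C. L v) {f \<in> Pi\<^sub>E V L. \<forall>(u, v)\<in>r. f u = f v}"
  proof (rule bij_betw_byWitness[where f' = \<Psi>])
    show "\<forall>g\<in>\<Pi>\<^sub>E C\<in>V // r. \<Inter>v\<in>C. L v. \<Psi> (\<Phi> g) = g"
    proof
      fix g assume g: "g \<in> (\<Pi>\<^sub>E C\<in>V // r. \<Inter>v\<in>C. L v)"
      show "\<Psi> (\<Phi> g) = g"
      proof
        fix C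
        show "\<Psi> (\<Phi> g) C = g C"
        proof (cases "C \<in> V // r")
          case True
          then show ?thesis
            using some_in[OF True] class_subset[OF True] class_eq[OF True]
            by (auto simp: \<Phi>_def \<Psi>_def)
        next
          case False
          then show ?thesis
            using g by (simp add: \<Psi>_def PiE_arb[OF g])
        qed
      qed
    qed
    show "\<forall>f\<in>{f \<in> Pi\<^sub>E V L. \<forall>(u, v)\<in>r. f u = f v}. \<Phi> (\<Psi> f) = f"
    proof
      fix f assume f: "f \<in> {f \<in> Pi\<^sub>E V L. \<forall>(u, v)\<in>r. f u = f v}"
      show "\<Phi> (\<Psi> f) = f"
      proof
        fix v
        show "\<Phi> (\<Psi> f) v = f v"
        proof (cases "v \<in> V")
          case True
          then have C: "r `` {v} \<in> V // r" by (rule quotientI)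
          have "(v, SOME w. w \<in> r `` {v}) \<in> r"
            using some_in[OF C] by simp
          then have "f (SOME w. w \<in> r `` {v}) = f v"
            using f by fastforce
          then show ?thesis
            using True C by (simp add: \<Phi>_def \<Psi>_def)
        next
          case False
          then show ?thesis
            using f by (auto simp: \<Phi>_def PiE_def extensional_def)
        qed
      qed
    qed
    show "\<Phi> ` (\<Pi>\<^sub>E C\<in>V // r. \<Inter>v\<in>C. L v) \<subseteq> {f \<in> Pi\<^sub>E V L. \<forall>(u, v)\<in>r. f u = f v}"
    proof (rule image_subsetI)
      fix g assume g: "g \<in> (\<Pi>\<^sub>E C\<in>V // r. \<Inter>v\<in>C. L v)"
      have "g (r `` {v}) \<in> L v" if "v \<in> V" for v
        using PiE_mem[OF g quotientI[OF that]] equiv_class_self[OF r that] by auto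
      moreover have "\<Phi> g u = \<Phi> g v" if "(u, v) \<in> r" for u v
        using that r equiv_class_eq[OF r that] by (auto simp: \<Phi>_def dest: equiv_class_eq_iff[THEN iffD1])
      ultimately show "\<Phi> g \<in> {f \<in> Pi\<^sub>E V L. \<forall>(u, v)\<in>r. f u = f v}"
        by (auto simp: \<Phi>_def)
    qed
    show "\<Psi> ` {f \<in> Pi\<^sub>E V L. \<forall>(u, v)\<in>r. f u = f v} \<subseteq> (\<Pi>\<^sub>E C\<in>V // r. \<Inter>v\<in>C. L v)"
    proof (rule image_subsetI)
      fix f assume f: "f \<in> {f \<in> Pi\<^sub>E V L. \<forall>(u, v)\<in>r. f u = f v}"
      have "f (SOME w. w \<in> C) \<in> L v" if "C \<in> V // r" "v \<in> C" for C v
      proof -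
        have "f (SOME w. w \<in> C) = f v"
          using f class_rel[OF that(1) some_in[OF that(1)] that(2)] by blast
        then show ?thesis
          using f class_subset[OF that(1)] that(2) by (auto simp: PiE_iff)
      qed
      then show "\<Psi> f \<in> (\<Pi>\<^sub>E C\<in>V // r. \<Inter>v\<in>C. L v)"
        by (auto simp: \<Psi>_def)
    qed
  qed
  then have "card {f \<in> Pi\<^sub>E V L. \<forall>(u, v)\<in>r. f u = f v} = card (\<Pi>\<^sub>E C\<in>V // r. \<Inter>v\<in>C. L v)"
    by (simp add: bij_betw_same_card)
  also have "\<dots> = (\<Prod>C\<in>V // r. card (\<Inter>v\<in>C. L v))"
    using assms by (intro card_PiE finite_quotient) (auto simp: equiv_def)
  finally show ?thesis .
qed

text \<open>An unordered pair has no first end, so both ways of writing it are quantified over. A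
  loop is always monochromatic.\<close>

definition monochromatic :: "('v, 'e) multigraph \<Rightarrow> ('v \<Rightarrow> 'c) \<Rightarrow> 'e \<Rightarrow> bool" where
  "monochromatic G c e \<longleftrightarrow> (\<forall>u v. ends G e = Upair u v \<longrightarrow> c u = c v)"

lemma monochromatic_Upair:
  "ends G e = Upair u v \<Longrightarrow> monochromatic G c e \<longleftrightarrow> c u = c v"
  by (auto simp: monochromatic_def)

text \<open>Properness asks for distinct colours in every ordering of the ends, the negation of
  \<open>monochromatic\<close> only in some ordering. The two agree because inequality is symmetric
  and every pair has an ordering.\<close>

lemma proper_list_colorings_altdef:
  "proper_list_colorings G L = {c \<in> Pi\<^sub>E (verts G) L. \<forall>e\<in>edges G. \<not> monochromatic G c e}"
proof -
  have "(\<forall>u v. ends G e = Upair u v \<longrightarrow> c u \<noteq> c v) \<longleftrightarrow> \<not> monochromatic G c e" for c :: "'a \<Rightarrow> nat" and e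
    by (cases "ends G e") (auto simp: monochromatic_def)
  then show ?thesis
    by (simp add: proper_list_colorings_def)
qed

lemma kdelta_uprod_map_uprod:
  "kdelta_uprod (map_uprod c (ends G e)) = of_bool (monochromatic G c e)"
  by (cases "ends G e") (auto simp: monochromatic_def kdelta_def)

context finite_multigraph
begin

lemma equiv_component_relation:
  "equiv (verts G) {(u, v) \<in> verts G \<times> verts G. (u, v) \<in> (adjacency G A)\<^sup>*}"
proof (intro equivI)
  have "sym (adjacency G A)"
    by (simp add: sym_def adjacency_def) (metis Upair_inject)
  then have "sym ((adjacency G A)\<^sup>*)"
    by (rule sym_rtrancl)
  then show "sym {(u, v) \<in> verts G \<times> verts G. (u, v) \<in> (adjacency G A)\<^sup>*}"
    by (auto simp: sym_def)
qed (auto simp: refl_on_def trans_def)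

text \<open>Equality of colours propagates along paths one edge at a time. Conversely, the ends of
  an edge of \<open>A\<close> are vertices of one component.\<close>

lemma constant_on_components_iff:
  assumes "A \<subseteq> edges G"
  shows "(\<forall>(u, v)\<in>{(u, v) \<in> verts G \<times> verts G. (u, v) \<in> (adjacency G A)\<^sup>*}. c u = c v)
     \<longleftrightarrow> (\<forall>e\<in>A. monochromatic G c e)" (is "?const \<longleftrightarrow> ?mono")
proof
  assume const: ?const
  show ?mono
  proof
    fix e assume "e \<in> A"
    obtain u v where uv: "ends G e = Upair u v"
      by (cases "ends G e")
    have "u \<in> verts G" "v \<in> verts G"
      using ends_in_verts[of e] \<open>e \<in> A\<close> assms uv by auto
    moreover have "(u, v) \<in> adjacency G A"
      using \<open>e \<in> A\<close> uv by (auto simp: adjacency_def)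
    ultimately show "monochromatic G c e"
      using const by (auto simp: monochromatic_Upair[OF uv])
  qed
next
  assume mono: ?mono
  have "c u = c v" if "(u, v) \<in> (adjacency G A)\<^sup>*" for u v
    using that
  proof (induction rule: rtrancl_induct)
    case (step v w)
    then show ?case
      using mono by (auto simp: adjacency_def dest: monochromatic_Upair[THEN iffD1, rotated])
  qed simp
  then show ?const by auto
qed

lemma card_monochromatic_colorings:
  assumes "A \<subseteq> edges G"
  shows "card {c \<in> Pi\<^sub>E (verts G) L. \<forall>e\<in>A. monochromatic G c e} =
           (\<Prod>C\<in>components G A. card (\<Inter>v\<in>C. L v))"
  using card_PiE_constant_on_classes[OF finite_verts equiv_component_relation, of L A]
  unfolding constant_on_components_iff[OF assms] components_def .

text \<open>Finiteness of the lists makes the set of list colourings finite, so that cardinalities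
  can be written as sums of indicators and the two sums exchanged.\<close>

lemma eval_list_chromatic_poly_card:
  assumes "\<And>v. v \<in> verts G \<Longrightarrow> finite (L v)"
  shows "eval_mpoly (\<lambda>l. of_nat (card l)) (list_chromatic_poly G L) =
           (of_nat (card (proper_list_colorings G L)) :: 'a::comm_ring_1)"
proof -
  let ?F = "Pi\<^sub>E (verts G) L"
  let ?m = "\<lambda>c e. of_bool (monochromatic G c e) :: 'a"
  have fin: "finite ?F"
    using assms finite_verts by (intro finite_PiE)
  have prod_of_bool: "(\<Prod>e\<in>A. of_bool (P e)) = (of_bool (\<forall>e\<in>A. P e) :: 'a)" if "finite A" for A :: "'e set" and P
    using that by (induction A) auto
  have "eval_mpoly (\<lambda>l. of_nat (card l)) (list_chromatic_poly G L) =
      (\<Sum>A\<in>Pow (edges G). (- 1) ^ card A *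
         of_nat (card {c \<in> ?F. \<forall>e\<in>A. monochromatic G c e}) :: 'a)"
    unfolding eval_list_chromatic_poly
    by (intro sum.cong refl) (simp add: card_monochromatic_colorings)
  also have "\<dots> = (\<Sum>A\<in>Pow (edges G). \<Sum>c\<in>?F. (- 1) ^ card A * (\<Prod>e\<in>A. ?m c e))"
  proof (intro sum.cong refl)
    fix A assume "A \<in> Pow (edges G)"
    then have "finite A"
      using finite_edges finite_subset by blast
    then show "(- 1) ^ card A * of_nat (card {c \<in> ?F. \<forall>e\<in>A. monochromatic G c e}) =
        (\<Sum>c\<in>?F. (- 1) ^ card A * (\<Prod>e\<in>A. ?m c e))"
      using fin by (simp add: prod_of_bool sum_distrib_left[symmetric] sum_of_bool_eq Int_def)
  qed
  also have "\<dots> = (\<Sum>c\<in>?F. \<Sum>A\<in>Pow (edges G). (- 1) ^ card A * (\<Prod>e\<in>A. ?m c e))"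
    by (rule sum.swap)
  \<comment> \<open>For a fixed colouring, the signed sum over \<open>A\<close> is the expansion of
    a product of differences, one for each edge; each factor is the indicator that its edge is not
    monochromatic.\<close>
  also have "\<dots> = (\<Sum>c\<in>?F. \<Prod>e\<in>edges G. 1 - ?m c e)"
    by (simp add: prod_diff_conv_sum[OF finite_edges])
  also have "\<dots> = (\<Sum>c\<in>?F. of_bool (\<forall>e\<in>edges G. \<not> monochromatic G c e))"
    by (simp add: prod_of_bool[OF finite_edges] flip: of_bool_not_iff)
  also have "\<dots> = of_nat (card (proper_list_colorings G L))"
    using fin by (simp add: proper_list_colorings_altdef sum_of_bool_eq Int_def)
  finally show ?thesis .
qed

end

section \<open>The zero-temperature limit\<close>

text \<open>For \<open>h = 0\<close> the weight is constantly 1. For \<open>h > 0\<close> the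
  exponent is a negative constant times \<open>1 / T\<close>, which tends to minus infinity as
  \<open>T\<close> decreases to 0.\<close>

lemma boltzmann_weight_tendsto:
  fixes h \<kappa> :: real
  assumes "h \<ge> 0" "\<kappa> > 0"
  shows "((\<lambda>T. exp (- (1 / (\<kappa> * T)) * h)) \<longlongrightarrow> of_bool (h = 0)) (at_right 0)"
proof (cases "h = 0")
  case False
  have "((\<lambda>T. exp (- (h / \<kappa>) * inverse T)) \<longlongrightarrow> 0) (at_right 0)"
    using assms False
    by (intro filterlim_compose[OF exp_at_bot]
          filterlim_tendsto_neg_mult_at_bot[OF tendsto_const _ filterlim_inverse_at_top_right]) auto
  then show ?thesis
    using False by (simp add: field_simps)
qed simp

text \<open>Only the summand for the colour \<open>\<sigma> v\<close> survives in the field term,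
  and that colour is in range because \<open>\<sigma>\<close> is a state. The signs move inside so
  that the summands can be seen to be non-negative.\<close>

lemma hamiltonian_altdef:
  assumes "\<sigma> \<in> states G q"
  shows "hamiltonian G J M q \<sigma> =
           (\<Sum>e\<in>edges G. - J e * of_bool (monochromatic G \<sigma> e)) + (\<Sum>v\<in>verts G. - M v (\<sigma> v))"
proof -
  have "(\<Sum>\<alpha>=1..q. M v \<alpha> * kdelta \<alpha> (\<sigma> v)) = M v (\<sigma> v)" if "v \<in> verts G" for v
  proof -
    have "(\<Sum>\<alpha>=1..q. M v \<alpha> * kdelta \<alpha> (\<sigma> v)) = (\<Sum>\<alpha>=1..q. if \<alpha> = \<sigma> v then M v \<alpha> else 0)"
      by (intro sum.cong) (auto simp: kdelta_def)
    moreover have "\<sigma> v \<in> {1..q}"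
      using assms that by (auto simp: states_def)
    ultimately show ?thesis
      by simp
  qed
  then show ?thesis
    by (simp add: hamiltonian_def kdelta_uprod_map_uprod sum_negf)
qed

context finite_multigraph
begin

context
  fixes q :: nat and J :: "'e \<Rightarrow> real" and M :: "'v \<Rightarrow> nat \<Rightarrow> real"
  assumes J_neg: "\<And>e. e \<in> edges G \<Longrightarrow> J e < 0"
    and M_nonpos: "\<And>v \<alpha>. v \<in> verts G \<Longrightarrow> \<alpha> \<in> {1..q} \<Longrightarrow> M v \<alpha> \<le> 0"
begin

lemma hamiltonian_nonneg_and_zero_iff:
  assumes "\<sigma> \<in> states G q"
  shows "hamiltonian G J M q \<sigma> \<ge> 0"
    and "hamiltonian G J M q \<sigma> = 0 \<longleftrightarrow> \<sigma> \<in> proper_list_colorings G (zero_field_list M q)"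
proof -
  let ?E = "\<Sum>e\<in>edges G. - J e * of_bool (monochromatic G \<sigma> e)"
  let ?F = "\<Sum>v\<in>verts G. - M v (\<sigma> v)"
  have \<sigma>_range: "\<sigma> v \<in> {1..q}" if "v \<in> verts G" for v
    using assms that by (auto simp: states_def)
  have E_terms: "- J e * of_bool (monochromatic G \<sigma> e) \<ge> 0" if "e \<in> edges G" for e
    using J_neg[OF that] by simp
  have F_terms: "- M v (\<sigma> v) \<ge> 0" if "v \<in> verts G" for v
    using M_nonpos[OF that \<sigma>_range[OF that]] by simp
  have "?E \<ge> 0" "?F \<ge> 0"
    by (rule sum_nonneg, erule E_terms) (rule sum_nonneg, erule F_terms)
  then show "hamiltonian G J M q \<sigma> \<ge> 0"
    by (simp only: hamiltonian_altdef[OF assms] add_nonneg_nonneg)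
  have "hamiltonian G J M q \<sigma> = 0 \<longleftrightarrow> ?E = 0 \<and> ?F = 0"
    unfolding hamiltonian_altdef[OF assms]
    by (rule add_nonneg_eq_0_iff) fact+
  also have "?E = 0 \<longleftrightarrow> (\<forall>e\<in>edges G. - J e * of_bool (monochromatic G \<sigma> e) = 0)"
    by (rule sum_nonneg_eq_0_iff[OF finite_edges E_terms])
  \<comment> \<open>Strict negativity of \<open>J e\<close> matters here: a monochromatic edge costs
    a positive amount of energy.\<close>
  also have "\<dots> \<longleftrightarrow> (\<forall>e\<in>edges G. \<not> monochromatic G \<sigma> e)"
    using J_neg by fastforce
  also have "?F = 0 \<longleftrightarrow> (\<forall>v\<in>verts G. - M v (\<sigma> v) = 0)"
    by (rule sum_nonneg_eq_0_iff[OF finite_verts F_terms])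
  also have "\<dots> \<longleftrightarrow> \<sigma> \<in> Pi\<^sub>E (verts G) (zero_field_list M q)"
    using assms by (auto simp: states_def zero_field_list_def PiE_iff)
  finally show "hamiltonian G J M q \<sigma> = 0 \<longleftrightarrow> \<sigma> \<in> proper_list_colorings G (zero_field_list M q)"
    by (auto simp: proper_list_colorings_altdef)
qed

lemma partition_function_tendsto:
  assumes "\<kappa> > 0"
  shows "(partition_function \<kappa> G J M q \<longlongrightarrow>
            real (card (proper_list_colorings G (zero_field_list M q)))) (at_right 0)"
proof -
  let ?P = "proper_list_colorings G (zero_field_list M q)"
  have fin: "finite (states G q)"
    unfolding states_def using finite_verts by (intro finite_PiE) auto
  \<comment> \<open>The lists lie in \<open>{1..q}\<close>, so summing the indicator over all states
    misses no proper list colouring.\<close>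
  have sub: "?P \<subseteq> states G q"
    unfolding proper_list_colorings_altdef states_def zero_field_list_def by (auto simp: PiE_iff extensional_def)
  have "(partition_function \<kappa> G J M q \<longlongrightarrow>
      (\<Sum>\<sigma>\<in>states G q. of_bool (hamiltonian G J M q \<sigma> = 0))) (at_right 0)"
    unfolding partition_function_def Let_def
    by (intro tendsto_sum boltzmann_weight_tendsto hamiltonian_nonneg_and_zero_iff(1) assms)
  also have "(\<Sum>\<sigma>\<in>states G q. of_bool (hamiltonian G J M q \<sigma> = 0)) =
      (\<Sum>\<sigma>\<in>states G q. of_bool (\<sigma> \<in> ?P) :: real)"
    by (intro sum.cong refl) (simp add: hamiltonian_nonneg_and_zero_iff(2))
  also have "\<dots> = real (card ?P)"
    using fin sub by (simp add: sum_of_bool_eq inf_absorb2)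
  finally show ?thesis .
qed

end

end

theorem theorem3p3:
  fixes G :: "('v, 'e) multigraph"
    and q :: nat
    and J :: "'e \<Rightarrow> real"
    and M :: "'v \<Rightarrow> nat \<Rightarrow> real"
    and \<kappa> :: real
  assumes "finite_multigraph G"
    and "\<kappa> > 0"
    and "\<And>e. e \<in> edges G \<Longrightarrow> J e < 0"
    and "\<And>v \<alpha>. v \<in> verts G \<Longrightarrow> \<alpha> \<in> {1..q} \<Longrightarrow> M v \<alpha> \<le> 0"
  defines "L \<equiv> zero_field_list M q"
  shows "((\<lambda>T. partition_function \<kappa> G J M q T) \<longlongrightarrow>
            eval_mpoly (\<lambda>l. real (card l)) (list_chromatic_poly G L)) (at_right 0)
       \<and> eval_mpoly (\<lambda>l. real (card l)) (list_chromatic_poly G L) =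
            real (card (proper_list_colorings G L))"
proof -
  interpret finite_multigraph G by fact
  have "eval_mpoly (\<lambda>l. real (card l)) (list_chromatic_poly G L) =
      real (card (proper_list_colorings G L))"
    by (rule eval_list_chromatic_poly_card) (simp add: L_def zero_field_list_def)
  moreover have "(partition_function \<kappa> G J M q \<longlongrightarrow> real (card (proper_list_colorings G L)))
      (at_right 0)"
    unfolding L_def by (rule partition_function_tendsto) (use assms in auto)
  ultimately show ?thesis
    by simp
qed

end
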